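(* Let $T>0$, $k\ge5$, let $\mathcal M_T\subset\Upsilon^k$ be a generic set (defined in the context), and let $(u_0,v_0)\in\mathcal M_T$ with initial measure of zero singular part. Then the curves $\mathbf C_i^W$, $i=1,\dots,N_1$, and $\mathbf C_j^Z$, $j=1,\dots,N_2$, associated with the corresponding global conservative solution are all separated from the initial line $\{t=0\}$ (i.e. they lie at positive distance from $\{0\}\times\mathbb R$).
   Context: **System.** The two-component Novikov system is $u_t+uvu_x+\partial_xP_1+P_2=0$, $v_t+uvv_x+\partial_xS_1+S_2=0$, with $P_1=(1-\partial_x^2)^{-1}(u^2v+uu_xv_x+\frac12vu_x^2)$, $P_2=\frac12(1-\partial_x^2)^{-1}(u_x^2v_x)$, $S_1=(1-\partial_x^2)^{-1}(uv^2+vu_xv_x+\frac12uv_x^2)$, $S_2=\frac12(1-\partial_x^2)^{-1}(u_xv_x^2)$. **Data spaces.** $\Sigma=\{(f,g):f,g\in H^1(\mathbb R),\ \int f_x^2g_x^2\,dx<\infty\}$, $d_\Sigma((f_1,g_1),(f_2,g_2))^2=\|f_1-f_2\|_{H^1}^2+\|g_1-g_2\|_{H^1}^2+\|f_{1x}g_{1x}-f_{2x}g_{2x}\|_{L^2}^2$. $\Upsilon^k=(C^k(\mathbb R))^2\cap\Sigma$ with $d_{\Upsilon^k}=d_\Sigma+\|f_1-f_2\|_{C^k}+\|g_1-g_2\|_{C^k}$. Convergence in $\Upsilon^{k-1}\cap C^k_{\mathrm{loc}}(\mathbb R)$ means convergence in $d_{\Upsilon^{k-1}}$ and in $C^k(-R,R)$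 for every $R>0$. **ODE system.** For $(U,V,W,Z,q)(t,\xi)$: $$U_t=-\partial_xP_1-P_2,\qquad V_t=-\partial_xS_1-S_2,$$ $$W_t=2U^2V\cos^2\tfrac W2-V\sin^2\tfrac W2-2(P_1+\partial_xP_2)\cos^2\tfrac W2,$$ $$Z_t=2UV^2\cos^2\tfrac Z2-U\sin^2\tfrac Z2-2(S_1+\partial_xS_2)\cos^2\tfrac Z2,$$ $$q_t=q\big(U^2V+\tfrac12V-P_1-\partial_xP_2\big)\sin W+q\big(UV^2+\tfrac12U-S_1-\partial_xS_2\big)\sin Z,$$ where, at $(t,\xi)$, $P_1=\frac12\int_{\mathbb R}\mathcal E(t,\xi,\eta)p_1(t,\eta)d\eta$, $P_2=\frac18\int_{\mathbb R}\mathcal E p_2\,d\eta$, $\partial_xP_1=\frac12(\int_\xi^\infty-\int_{-\infty}^\xi)\mathcal E p_1\,d\eta$, $\partial_xP_2=\frac18(\int_\xi^\infty-\int_{-\infty}^\xi)\mathcal Ep_2\,d\eta$, and $S_1,S_2,\partial_xS_1,\partial_xS_2$ are given by the same formulas with $s_1,s_2$ in place of $p_1,p_2$; here $\mathcal E(t,\xi,\eta)=\exp\big(-\big|\int_\eta^\xi(q\cos^2\frac W2\cos^2\frac Z2)(t,s)ds\big|\big)$, $p_1=q(U^2V\cos^2\frac W2\cos^2\frac Z2+\frac14U\sin W\sin Z+\frac12V\sin^2\frac W2\cos^2\frac Z2)$, $s_1=q(UV^2\cos^2\frac W2\cos^2\frac Z2+\frac12U\cos^2\frac W2\sin^2\frac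 Z2+\frac14V\sin W\sin Z)$, $p_2=q\sin^2\frac W2\sin Z$, $s_2=q\sin W\sin^2\frac Z2$. The values of $W$ and $Z$ are understood modulo $2\pi$, with representatives in $(-\pi,\pi]$. **Global conservative solution (zero singular part: $d\mu_0=((\partial_xu_0)^2+(\partial_xv_0)^2+(\partial_xu_0)^2(\partial_xv_0)^2)dx$).** Define $y_0$ by $\int_0^{y_0(\xi)}(1+(\partial_xu_0)^2)(1+(\partial_xv_0)^2)dx=\xi$, and let $(U,V,W,Z,q)$ be the unique global solution of the ODE system with data $U_0=u_0\circ y_0$, $V_0=v_0\circ y_0$, $W_0=2\arctan((\partial_xu_0)\circ y_0)$, $Z_0=2\arctan((\partial_xv_0)\circ y_0)$, $q_0=1$. Put $y(t,\xi)=y_0(\xi)+\int_0^t(UV)(\tau,\xi)d\tau$. Then $u(t,x)=U(t,\xi)$, $v(t,x)=V(t,\xi)$ whenever $x=y(t,\xi)$, and $\mu_{(t)}([a,b])=\int_{\{\xi:y(t,\xi)\in[a,b]\}}\big(\cos^2\frac W2\sin^2\frac Z2+\sin^2\frac W2\cos^2\frac Z2+\sin^2\frac W2\sin^2\frac Z2\big)q\,(t,\xi)\,d\xi$. **Generic set and curves.** $\mathcal M_T\subset\Upsilon^k$ is a set, open in $\Upsilon^k$ and dense in $\Upsilon^{k-1}\cap C^k_{\mathrm{loc}}(\mathbb R)$, such that for every $(u_0,v_0)\in\mathcal M_T$ the global conservative solution $(u(t),v(t),\mu_{(t)})$ of the two-component Novikov system with initial data $(u_0,v_0)$ and initial measure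 $d\mu_0=((\partial_xu_0)^2+(\partial_xv_0)^2+(\partial_xu_0)^2(\partial_xv_0)^2)dx$, together with the ODE solution $(U,V,W,Z,q)$ and the characteristic $y$ from which it is constructed, has the following properties. With $\Gamma^W=\{(t,\xi)\in[-T,T]\times\mathbb R:W=\pi\}$, $\Gamma^Z=\{(t,\xi)\in[-T,T]\times\mathbb R:Z=\pi\}$: $(W_t,W_\xi)\ne(0,0)$ and $(W_\xi,W_{\xi\xi})\ne(0,0)$ on $\Gamma^W$; $(Z_t,Z_\xi)\ne(0,0)$ and $(Z_\xi,Z_{\xi\xi})\neq(0,0)$ on $\Gamma^Z$; the images of $\Gamma^W$, $\Gamma^Z$ under $(t,\xi)\mapsto(t,y(t,\xi))$ are finite (possibly empty) unions of piecewise $C^{k-1}$ curves $\mathbf C_i^W$ ($i\le N_1$), respectively $\mathbf C_j^Z$ ($j\le N_2$), which within each family are pairwise disjoint, bounded, without self-intersections, and closed or with endpoints on $\{\pm T\}\times\mathbb R$; $u,v$ are $C^k$ in $[-T,T]\times\mathbb R$ off all these curves; $u$ is $C^1$ off $\bigcup\mathbf C_i^W$ and $v$ is $C^1$ off $\bigcup\mathbf C_j^Z$; and $d\mu_{(t)}=(u_x^2+v_x^2+u_x^2v_x^2)dx$ for all $t\in[-T,T]$. (Such a set exists for each $T>0$, $k\ge5$.) *)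

theory Defs
  imports "HOL-Analysis.Analysis"
begin

section \<open>Function spaces on the real line\<close>

text \<open>\<open>C\<^sup>k\<close> regularity on an interval or on the whole line; \<open>D j\<close> is the \<open>j\<close>-th derivative
  (one-sided at end points of \<open>S\<close> belonging to \<open>S\<close>).\<close>

definition Ck_on :: "nat \<Rightarrow> real set \<Rightarrow> (real \<Rightarrow> 'a::real_normed_vector) \<Rightarrow> bool" where
  "Ck_on k S f \<longleftrightarrow>
     (\<exists>D. (\<forall>x\<in>S. D 0 x = f x) \<and>
          (\<forall>j<k. \<forall>x\<in>S. (D j has_vector_derivative D (Suc j) x) (at x within S)) \<and>
          continuous_on S (D k))"

definition Ck_norm_on :: "nat \<Rightarrow> real set \<Rightarrow> (real \<Rightarrow> real) \<Rightarrow> real" where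
  "Ck_norm_on k S f = (\<Sum>j\<le>k. SUP x\<in>S. \<bar>(deriv ^^ j) f x\<bar>)"

text \<open>\<open>C\<^sup>k(\<real>)\<close> is the space normed by \<^term>\<open>Ck_norm_on k UNIV\<close>, so the derivatives up to
  order \<open>k\<close> are bounded.\<close>

definition Ck_bounded :: "nat \<Rightarrow> (real \<Rightarrow> real) \<Rightarrow> bool" where
  "Ck_bounded k f \<longleftrightarrow> Ck_on k UNIV f \<and> (\<forall>j\<le>k. bounded (range ((deriv ^^ j) f)))"

definition in_L2 :: "(real \<Rightarrow> real) \<Rightarrow> bool" where
  "in_L2 f \<longleftrightarrow> f \<in> borel_measurable lborel \<and> integrable lborel (\<lambda>x. (f x)\<^sup>2)"

definition L2_norm :: "(real \<Rightarrow> real) \<Rightarrow> real" where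
  "L2_norm f = sqrt (LINT x|lborel. (f x)\<^sup>2)"

definition test_function :: "(real \<Rightarrow> real) \<Rightarrow> bool" where
  "test_function \<phi> \<longleftrightarrow> (\<forall>n. Ck_on n UNIV \<phi>) \<and> bounded {x. \<phi> x \<noteq> 0}"

definition L2_weak_deriv :: "(real \<Rightarrow> real) \<Rightarrow> (real \<Rightarrow> real) \<Rightarrow> bool" where
  "L2_weak_deriv f g \<longleftrightarrow> in_L2 f \<and> in_L2 g \<and>
     (\<forall>\<phi>. test_function \<phi> \<longrightarrow>
        (LINT x|lborel. f x * deriv \<phi> x) = - (LINT x|lborel. g x * \<phi> x))"

definition in_H1 :: "(real \<Rightarrow> real) \<Rightarrow> bool" where
  "in_H1 f \<longleftrightarrow> (\<exists>g. L2_weak_deriv f g)"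

text \<open>Determined only up to a null set; it is used only under integrals.\<close>

definition weak_deriv :: "(real \<Rightarrow> real) \<Rightarrow> real \<Rightarrow> real" where
  "weak_deriv f = (SOME g. L2_weak_deriv f g)"

definition H1_norm :: "(real \<Rightarrow> real) \<Rightarrow> real" where
  "H1_norm f = sqrt ((L2_norm f)\<^sup>2 + (L2_norm (weak_deriv f))\<^sup>2)"

type_synonym data = "(real \<Rightarrow> real) \<times> (real \<Rightarrow> real)"

definition Sigma_space :: "data set" where
  "Sigma_space = {(f, g). in_H1 f \<and> in_H1 g \<and>
     integrable lborel (\<lambda>x. (weak_deriv f x)\<^sup>2 * (weak_deriv g x)\<^sup>2)}"

fun Sigma_dist :: "data \<Rightarrow> data \<Rightarrow> real" where
  "Sigma_dist (f1, g1) (f2, g2) =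
     sqrt ((H1_norm (\<lambda>x. f1 x - f2 x))\<^sup>2 + (H1_norm (\<lambda>x. g1 x - g2 x))\<^sup>2
       + (L2_norm (\<lambda>x. weak_deriv f1 x * weak_deriv g1 x
                        - weak_deriv f2 x * weak_deriv g2 x))\<^sup>2)"

definition Upsilon :: "nat \<Rightarrow> data set" where
  "Upsilon k = {(f, g). Ck_bounded k f \<and> Ck_bounded k g} \<inter> Sigma_space"

fun Ck_dist_on :: "nat \<Rightarrow> real set \<Rightarrow> data \<Rightarrow> data \<Rightarrow> real" where
  "Ck_dist_on k S (f1, g1) (f2, g2) =
     Ck_norm_on k S (\<lambda>x. f1 x - f2 x) + Ck_norm_on k S (\<lambda>x. g1 x - g2 x)"

definition Upsilon_dist :: "nat \<Rightarrow> data \<Rightarrow> data \<Rightarrow> real" where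
  "Upsilon_dist k a b = Sigma_dist a b + Ck_dist_on k UNIV a b"

definition open_in_Upsilon :: "nat \<Rightarrow> data set \<Rightarrow> bool" where
  "open_in_Upsilon k M \<longleftrightarrow> M \<subseteq> Upsilon k \<and>
     (\<forall>a\<in>M. \<exists>\<epsilon>>0. \<forall>b\<in>Upsilon k. Upsilon_dist k a b < \<epsilon> \<longrightarrow> b \<in> M)"

text \<open>Every element of \<open>\<Upsilon>\<^sup>k\<close> is a limit, in the sense of \<open>\<Upsilon>\<^sup>k\<^sup>-\<^sup>1 \<inter> C\<^sup>k\<^sub>l\<^sub>o\<^sub>c(\<real>)\<close>, of a sequence
  in \<open>M\<close>.\<close>

definition dense_Upsilon_loc :: "nat \<Rightarrow> data set \<Rightarrow> bool" where
  "dense_Upsilon_loc k M \<longleftrightarrow>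
     (\<forall>a\<in>Upsilon k. \<exists>s::nat \<Rightarrow> data. (\<forall>n. s n \<in> M) \<and>
        (\<lambda>n. Upsilon_dist (k - 1) (s n) a) \<longlonglongrightarrow> 0 \<and>
        (\<forall>R>0. (\<lambda>n. Ck_dist_on k {-R<..<R} (s n) a) \<longlonglongrightarrow> 0))"


section \<open>The ODE system in Lagrangian variables\<close>

text \<open>Functions of \<open>(t, \<xi>)\<close> are curried. The angles \<open>W\<close> and \<open>Z\<close> take values modulo \<open>2\<pi>\<close>; here
  they are represented by real-valued lifts that are differentiable in time. All right-hand sides
  are \<open>2\<pi>\<close>-periodic in the angles, and \<^term>\<open>Arg (cis w)\<close> is the representative of \<open>w\<close>
  in \<open>(-\<pi>, \<pi>]\<close>.\<close>

context
  fixes U V W Z q :: "real \<Rightarrow> real \<Rightarrow> real"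
begin

definition kernel_E :: "real \<Rightarrow> real \<Rightarrow> real \<Rightarrow> real" where
  "kernel_E t \<xi> \<eta> =
     exp (- \<bar>LBINT s=\<eta>..\<xi>. q t s * (cos (W t s / 2))\<^sup>2 * (cos (Z t s / 2))\<^sup>2\<bar>)"

definition dens_p1 :: "real \<Rightarrow> real \<Rightarrow> real" where
  "dens_p1 t \<eta> = q t \<eta> *
     ((U t \<eta>)\<^sup>2 * V t \<eta> * (cos (W t \<eta> / 2))\<^sup>2 * (cos (Z t \<eta> / 2))\<^sup>2
      + 1/4 * U t \<eta> * sin (W t \<eta>) * sin (Z t \<eta>)
      + 1/2 * V t \<eta> * (sin (W t \<eta> / 2))\<^sup>2 * (cos (Z t \<eta> / 2))\<^sup>2)"

definition dens_s1 :: "real \<Rightarrow> real \<Rightarrow> real" where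
  "dens_s1 t \<eta> = q t \<eta> *
     (U t \<eta> * (V t \<eta>)\<^sup>2 * (cos (W t \<eta> / 2))\<^sup>2 * (cos (Z t \<eta> / 2))\<^sup>2
      + 1/2 * U t \<eta> * (cos (W t \<eta> / 2))\<^sup>2 * (sin (Z t \<eta> / 2))\<^sup>2
      + 1/4 * V t \<eta> * sin (W t \<eta>) * sin (Z t \<eta>))"

definition dens_p2 :: "real \<Rightarrow> real \<Rightarrow> real" where
  "dens_p2 t \<eta> = q t \<eta> * (sin (W t \<eta> / 2))\<^sup>2 * sin (Z t \<eta>)"

definition dens_s2 :: "real \<Rightarrow> real \<Rightarrow> real" where
  "dens_s2 t \<eta> = q t \<eta> * sin (W t \<eta>) * (sin (Z t \<eta> / 2))\<^sup>2"

definition int_E :: "(real \<Rightarrow> real \<Rightarrow> real) \<Rightarrow> real \<Rightarrow> real \<Rightarrow> real" where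
  "int_E p t \<xi> = (LINT \<eta>|lborel. kernel_E t \<xi> \<eta> * p t \<eta>)"

definition sgn_int_E :: "(real \<Rightarrow> real \<Rightarrow> real) \<Rightarrow> real \<Rightarrow> real \<Rightarrow> real" where
  "sgn_int_E p t \<xi> = (LINT \<eta>:{\<xi>..}|lborel. kernel_E t \<xi> \<eta> * p t \<eta>)
                    - (LINT \<eta>:{..\<xi>}|lborel. kernel_E t \<xi> \<eta> * p t \<eta>)"

definition "pot_P1 t \<xi> = 1/2 * int_E dens_p1 t \<xi>"
definition "pot_P2 t \<xi> = 1/8 * int_E dens_p2 t \<xi>"
definition "pot_dxP1 t \<xi> = 1/2 * sgn_int_E dens_p1 t \<xi>"
definition "pot_dxP2 t \<xi> = 1/8 * sgn_int_E dens_p2 t \<xi>"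
definition "pot_S1 t \<xi> = 1/2 * int_E dens_s1 t \<xi>"
definition "pot_S2 t \<xi> = 1/8 * int_E dens_s2 t \<xi>"
definition "pot_dxS1 t \<xi> = 1/2 * sgn_int_E dens_s1 t \<xi>"
definition "pot_dxS2 t \<xi> = 1/8 * sgn_int_E dens_s2 t \<xi>"

definition ode_system :: bool where
  "ode_system \<longleftrightarrow> (\<forall>t \<xi>.
     ((\<lambda>\<tau>. U \<tau> \<xi>) has_real_derivative (- pot_dxP1 t \<xi> - pot_P2 t \<xi>)) (at t) \<and>
     ((\<lambda>\<tau>. V \<tau> \<xi>) has_real_derivative (- pot_dxS1 t \<xi> - pot_S2 t \<xi>)) (at t) \<and>
     ((\<lambda>\<tau>. W \<tau> \<xi>) has_real_derivative
        (2 * (U t \<xi>)\<^sup>2 * V t \<xi> * (cos (W t \<xi> / 2))\<^sup>2 - V t \<xi> * (sin (W t \<xi> / 2))\<^sup>2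
         - 2 * (pot_P1 t \<xi> + pot_dxP2 t \<xi>) * (cos (W t \<xi> / 2))\<^sup>2)) (at t) \<and>
     ((\<lambda>\<tau>. Z \<tau> \<xi>) has_real_derivative
        (2 * U t \<xi> * (V t \<xi>)\<^sup>2 * (cos (Z t \<xi> / 2))\<^sup>2 - U t \<xi> * (sin (Z t \<xi> / 2))\<^sup>2
         - 2 * (pot_S1 t \<xi> + pot_dxS2 t \<xi>) * (cos (Z t \<xi> / 2))\<^sup>2)) (at t) \<and>
     ((\<lambda>\<tau>. q \<tau> \<xi>) has_real_derivative
        (q t \<xi> * ((U t \<xi>)\<^sup>2 * V t \<xi> + 1/2 * V t \<xi> - pot_P1 t \<xi> - pot_dxP2 t \<xi>) * sin (W t \<xi>)
         + q t \<xi> * (U t \<xi> * (V t \<xi>)\<^sup>2 + 1/2 * U t \<xi> - pot_S1 t \<xi> - pot_dxS2 t \<xi>) * sin (Z t \<xi>)))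
        (at t))"

text \<open>The class in which the system is solved: \<open>U, V, W, Z\<close> in \<open>L\<^sup>2 \<inter> L\<^sup>\<infinity>\<close> and \<open>q\<close> in \<open>L\<^sup>\<infinity>\<close>, with
  bounds that are locally uniform in time. In particular all integrals above converge.\<close>

definition solution_class :: bool where
  "solution_class \<longleftrightarrow>
     (\<forall>t. in_L2 (U t) \<and> in_L2 (V t) \<and> in_L2 (W t) \<and> in_L2 (Z t) \<and>
          q t \<in> borel_measurable lborel) \<and>
     (\<forall>\<tau>. \<exists>B. \<forall>t\<in>{-\<tau>..\<tau>}.
        L2_norm (U t) \<le> B \<and> L2_norm (V t) \<le> B \<and> L2_norm (W t) \<le> B \<and> L2_norm (Z t) \<le> B \<and>
        (\<forall>\<xi>. \<bar>U t \<xi>\<bar> \<le> B \<and> \<bar>V t \<xi>\<bar> \<le> B \<and> \<bar>W t \<xi>\<bar> \<le> B \<and> \<bar>Z t \<xi>\<bar> \<le> B \<and> \<bar>q t \<xi>\<bar> \<le> B))"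

definition global_ode_solution :: "(real \<Rightarrow> real) \<Rightarrow> (real \<Rightarrow> real) \<Rightarrow> (real \<Rightarrow> real) \<Rightarrow> bool" where
  "global_ode_solution u0 v0 y0 \<longleftrightarrow> solution_class \<and> ode_system \<and>
     (\<forall>\<xi>. U 0 \<xi> = u0 (y0 \<xi>) \<and> V 0 \<xi> = v0 (y0 \<xi>) \<and>
          W 0 \<xi> = 2 * arctan (deriv u0 (y0 \<xi>)) \<and>
          Z 0 \<xi> = 2 * arctan (deriv v0 (y0 \<xi>)) \<and>
          q 0 \<xi> = 1)"

end


section \<open>Global conservative solutions\<close>

definition ac_energy :: "(real \<Rightarrow> real) \<Rightarrow> (real \<Rightarrow> real) \<Rightarrow> real measure" where
  "ac_energy u v = density lborel
     (\<lambda>x. ennreal ((deriv u x)\<^sup>2 + (deriv v x)\<^sup>2 + (deriv u x)\<^sup>2 * (deriv v x)\<^sup>2))"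

text \<open>The global conservative solution \<open>(u, v, \<mu>)\<close> for continuously differentiable data
  \<open>(u0, v0)\<close> and an initial measure without singular part, together with the Lagrangian
  variables from which it is built.\<close>

definition conservative_solution ::
  "data \<Rightarrow> (real \<Rightarrow> real \<Rightarrow> real) \<Rightarrow> (real \<Rightarrow> real \<Rightarrow> real) \<Rightarrow> (real \<Rightarrow> real \<Rightarrow> real)
    \<Rightarrow> (real \<Rightarrow> real \<Rightarrow> real) \<Rightarrow> (real \<Rightarrow> real \<Rightarrow> real) \<Rightarrow> (real \<Rightarrow> real \<Rightarrow> real)
    \<Rightarrow> (real \<Rightarrow> real \<Rightarrow> real) \<Rightarrow> (real \<Rightarrow> real \<Rightarrow> real) \<Rightarrow> (real \<Rightarrow> real measure) \<Rightarrow> bool" where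
  "conservative_solution d U V W Z q y u v \<mu> \<longleftrightarrow>
    (case d of (u0, v0) \<Rightarrow> \<exists>y0.
      (\<forall>\<xi>. (LBINT x=0..y0 \<xi>. (1 + (deriv u0 x)\<^sup>2) * (1 + (deriv v0 x)\<^sup>2)) = \<xi>) \<and>
      global_ode_solution U V W Z q u0 v0 y0 \<and>
      (\<forall>t \<xi>. y t \<xi> = y0 \<xi> + (LBINT \<tau>=0..t. U \<tau> \<xi> * V \<tau> \<xi>)) \<and>
      (\<forall>t \<xi>. u t (y t \<xi>) = U t \<xi> \<and> v t (y t \<xi>) = V t \<xi>) \<and>
      \<mu> 0 = ac_energy u0 v0 \<and>
      (\<forall>t. sets (\<mu> t) = sets borel \<and>
        (\<forall>a b. a \<le> b \<longrightarrow> emeasure (\<mu> t) {a..b} =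
          (\<integral>\<^sup>+ \<xi>\<in>{\<xi>. y t \<xi> \<in> {a..b}}. ennreal
            (((cos (W t \<xi> / 2))\<^sup>2 * (sin (Z t \<xi> / 2))\<^sup>2
              + (sin (W t \<xi> / 2))\<^sup>2 * (cos (Z t \<xi> / 2))\<^sup>2
              + (sin (W t \<xi> / 2))\<^sup>2 * (sin (Z t \<xi> / 2))\<^sup>2) * q t \<xi>) \<partial>lborel))))"


section \<open>Singular curves and generic sets\<close>

definition Gamma_set :: "real \<Rightarrow> (real \<Rightarrow> real \<Rightarrow> real) \<Rightarrow> (real \<times> real) set" where
  "Gamma_set T A = {(t, \<xi>). t \<in> {-T..T} \<and> Arg (cis (A t \<xi>)) = pi}"

definition nondegenerate_on :: "(real \<times> real) set \<Rightarrow> (real \<Rightarrow> real \<Rightarrow> real) \<Rightarrow> bool" where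
  "nondegenerate_on \<Gamma> A \<longleftrightarrow> (\<forall>(t, \<xi>)\<in>\<Gamma>.
     (\<lambda>\<tau>. A \<tau> \<xi>) field_differentiable at t \<and>
     A t field_differentiable at \<xi> \<and> deriv (A t) field_differentiable at \<xi> \<and>
     (deriv (\<lambda>\<tau>. A \<tau> \<xi>) t, deriv (A t) \<xi>) \<noteq> (0, 0) \<and>
     (deriv (A t) \<xi>, deriv (deriv (A t)) \<xi>) \<noteq> (0, 0))"

definition piecewise_Ck_path :: "nat \<Rightarrow> (real \<Rightarrow> real \<times> real) \<Rightarrow> bool" where
  "piecewise_Ck_path m g \<longleftrightarrow> (\<exists>n::nat. \<exists>a::nat \<Rightarrow> real. a 0 = 0 \<and> a n = 1 \<and>
     (\<forall>i<n. a i < a (Suc i) \<and> Ck_on m {a i..a (Suc i)} g))"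

definition curve_family ::
  "real \<Rightarrow> nat \<Rightarrow> (real \<times> real) set \<Rightarrow> (real \<Rightarrow> real \<Rightarrow> real) \<Rightarrow> nat
    \<Rightarrow> (nat \<Rightarrow> real \<Rightarrow> real \<times> real) \<Rightarrow> bool" where
  "curve_family T m \<Gamma> y N C \<longleftrightarrow>
     (\<lambda>(t, \<xi>). (t, y t \<xi>)) ` \<Gamma> = (\<Union>i\<in>{1..N}. path_image (C i)) \<and>
     disjoint_family_on (\<lambda>i. path_image (C i)) {1..N} \<and>
     (\<forall>i\<in>{1..N}. simple_path (C i) \<and> piecewise_Ck_path m (C i) \<and> bounded (path_image (C i)) \<and>
        (pathfinish (C i) = pathstart (C i) \<or>
         (pathstart (C i) \<in> {-T, T} \<times> UNIV \<and> pathfinish (C i) \<in> {-T, T} \<times> UNIV)))"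

text \<open>\<open>C\<^sup>k\<close> regularity on a subset of the \<open>(t, x)\<close>-plane that is relatively open in a closed
  strip; derivatives are one-sided on the boundary of the strip.\<close>

fun Ck2_on :: "nat \<Rightarrow> (real \<times> real) set \<Rightarrow> (real \<times> real \<Rightarrow> real) \<Rightarrow> bool" where
  "Ck2_on 0 S f \<longleftrightarrow> continuous_on S f"
| "Ck2_on (Suc n) S f \<longleftrightarrow> (\<exists>ft fx.
     (\<forall>p\<in>S. (f has_derivative (\<lambda>h. ft p * fst h + fx p * snd h)) (at p within S)) \<and>
     Ck2_on n S ft \<and> Ck2_on n S fx)"

definition generic_regularity ::
  "real \<Rightarrow> nat \<Rightarrow> (real \<Rightarrow> real \<Rightarrow> real) \<Rightarrow> (real \<Rightarrow> real \<Rightarrow> real) \<Rightarrow> (real \<Rightarrow> real \<Rightarrow> real)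
    \<Rightarrow> (real \<Rightarrow> real \<Rightarrow> real) \<Rightarrow> (real \<Rightarrow> real \<Rightarrow> real) \<Rightarrow> (real \<Rightarrow> real measure)
    \<Rightarrow> nat \<Rightarrow> (nat \<Rightarrow> real \<Rightarrow> real \<times> real) \<Rightarrow> nat \<Rightarrow> (nat \<Rightarrow> real \<Rightarrow> real \<times> real) \<Rightarrow> bool" where
  "generic_regularity T k W Z y u v \<mu> N1 CW N2 CZ \<longleftrightarrow>
     nondegenerate_on (Gamma_set T W) W \<and> nondegenerate_on (Gamma_set T Z) Z \<and>
     curve_family T (k - 1) (Gamma_set T W) y N1 CW \<and>
     curve_family T (k - 1) (Gamma_set T Z) y N2 CZ \<and>
     (let strip = {-T..T} \<times> (UNIV :: real set);
          KW = (\<Union>i\<in>{1..N1}. path_image (CW i));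
          KZ = (\<Union>j\<in>{1..N2}. path_image (CZ j))
      in Ck2_on k (strip - (KW \<union> KZ)) (\<lambda>(t, x). u t x) \<and>
         Ck2_on k (strip - (KW \<union> KZ)) (\<lambda>(t, x). v t x) \<and>
         Ck2_on 1 (strip - KW) (\<lambda>(t, x). u t x) \<and>
         Ck2_on 1 (strip - KZ) (\<lambda>(t, x). v t x)) \<and>
     (\<forall>t\<in>{-T..T}. \<mu> t = ac_energy (u t) (v t))"

definition generic_set :: "real \<Rightarrow> nat \<Rightarrow> data set \<Rightarrow> bool" where
  "generic_set T k M \<longleftrightarrow> open_in_Upsilon k M \<and> dense_Upsilon_loc k M \<and>
     (\<forall>d\<in>M.
        (\<exists>U V W Z q y u v \<mu>. conservative_solution d U V W Z q y u v \<mu>) \<and>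
        (\<forall>U V W Z q y u v \<mu>. conservative_solution d U V W Z q y u v \<mu> \<longrightarrow>
           (\<exists>N1 CW N2 CZ. generic_regularity T k W Z y u v \<mu> N1 CW N2 CZ)))"

end

theory Submission
  imports Defs
begin

text \<open>The angle \<open>W\<close> reaches pi modulo 2 pi only where the slope of
  \<open>u\<close> becomes infinite, and likewise \<open>Z\<close> for \<open>v\<close>. At time 0
  both angles are 2 arctan of a finite slope, hence strictly between -pi and pi, so neither singular
  set meets t = 0 (\<open>time_zero_notin_Gamma_set\<close>). The map (t, \<xi>) to (t, y t \<xi>)
  keeps the time, so no curve meets the initial line; as each curve is compact and the line is
  closed, disjointness becomes positive distance
  (\<open>curve_family_setdist_time_zero_pos\<close>).\<close>

lemma time_zero_notin_Gamma_set:
  assumes "A 0 \<xi> = 2 * arctan z"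
  shows "(0, \<xi>) \<notin> Gamma_set T A"
proof -
  have "- pi < A 0 \<xi>" "A 0 \<xi> < pi"
    using assms arctan_lbound[of z] arctan_ubound[of z] by auto
  \<comment> \<open>The initial lift is already the principal representative, so reduction modulo 2
    pi cannot turn it into pi.\<close>
  then have "Arg (cis (A 0 \<xi>)) = A 0 \<xi>"
    by (intro cis_Arg_unique) (auto simp: sgn_div_norm)
  with \<open>A 0 \<xi> < pi\<close> show ?thesis
    by (simp add: Gamma_set_def)
qed

text \<open>Stated for an arbitrary \<Gamma> so that it serves both families of curves.\<close>

lemma curve_family_setdist_time_zero_pos:
  assumes "\<And>\<xi>. (0, \<xi>) \<notin> \<Gamma>" and "curve_family T m \<Gamma> y N C" and "i \<in> {1..N}"
  shows "setdist (path_image (C i)) ({0} \<times> UNIV) > 0"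
proof -
  have image: "(\<lambda>(t, \<xi>). (t, y t \<xi>)) ` \<Gamma> = (\<Union>i\<in>{1..N}. path_image (C i))"
    and "path (C i)"
    using assms(2,3) by (auto simp: curve_family_def simple_path_imp_path)
  have "path_image (C i) \<subseteq> (\<lambda>(t, \<xi>). (t, y t \<xi>)) ` \<Gamma>"
    unfolding image using assms(3) by blast
  \<comment> \<open>A curve point at time 0 would come from a point of \<Gamma> at time 0.\<close>
  with assms(1) have "path_image (C i) \<inter> ({0} \<times> UNIV) = {}"
    by auto
  moreover have "closed ({0::real} \<times> (UNIV :: real set))"
    by (intro closed_Times) auto
  \<comment> \<open>\<open>setdist\<close> is 0 by convention when a set is empty, hence the
    nonemptiness of the path image.\<close>
  ultimately have "setdist (path_image (C i)) ({0} \<times> UNIV) \<noteq> 0"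
    using compact_path_image[OF \<open>path (C i)\<close>] path_image_nonempty[of "C i"]
    by (subst setdist_eq_0_compact_closed) auto
  then show ?thesis
    using setdist_pos_le[of "path_image (C i)" "{0} \<times> UNIV"] by linarith
qed

theorem corollary1p12:
  fixes T :: real and k N1 N2 :: nat and M :: "data set"
    and u0 v0 :: "real \<Rightarrow> real"
    and U V W Z q y u v :: "real \<Rightarrow> real \<Rightarrow> real"
    and \<mu> :: "real \<Rightarrow> real measure"
    and CW CZ :: "nat \<Rightarrow> real \<Rightarrow> real \<times> real"
  assumes "T > 0" and "k \<ge> 5"
    and "generic_set T k M" and "(u0, v0) \<in> M"
    and "conservative_solution (u0, v0) U V W Z q y u v \<mu>"
    and "curve_family T (k - 1) (Gamma_set T W) y N1 CW"
    and "curve_family T (k - 1) (Gamma_set T Z) y N2 CZ"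
  shows "(\<forall>i\<in>{1..N1}. setdist (path_image (CW i)) ({0} \<times> UNIV) > 0) \<and>
         (\<forall>j\<in>{1..N2}. setdist (path_image (CZ j)) ({0} \<times> UNIV) > 0)"
proof -
  obtain y0 where "W 0 \<xi> = 2 * arctan (deriv u0 (y0 \<xi>))"
    and "Z 0 \<xi> = 2 * arctan (deriv v0 (y0 \<xi>))" for \<xi>
    using assms(5) by (auto simp: conservative_solution_def global_ode_solution_def)
  then have "(0, \<xi>) \<notin> Gamma_set T W" "(0, \<xi>) \<notin> Gamma_set T Z" for \<xi>
    using time_zero_notin_Gamma_set by blast+
  with assms(6,7) show ?thesis
    by (blast intro: curve_family_setdist_time_zero_pos)
qed

end
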